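(* Let $G$ be a transitive permutation group on a set $\Omega$, with $H=G_\alpha$ the stabiliser of some $\alpha\in\Omega$, and let $C:=C_S(G)$ be the centraliser of $G$ in the symmetric group $S:={\rm Sym}(\Omega)$. Then (1) $C\cong N_G(H)/H$; (2) $C$ acts regularly on the set $\Phi=\{\beta\in\Omega\mid G_\beta=H\}$ of elements of $\Omega$ with stabiliser $H$.
   Context: A permutation group on $\Omega$ is a subgroup of ${\rm Sym}(\Omega)$; the set $\Omega$ and the group $G$ may be infinite. $G_\beta$ denotes the stabiliser of $\beta\in\Omega$ in $G$, and $N_G(H)$ is the normaliser of $H$ in $G$. A group acts regularly on a set if it leaves the set invariant and acts on it transitively with trivial point stabilisers. *)

theory Defs
  imports "HOL-Algebra.Group_Action"
begin

definition centralizer :: "('a, 'b) monoid_scheme \<Rightarrow> 'a set \<Rightarrow> 'a set"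
  where "centralizer S K =
    {x \<in> carrier S. \<forall>y \<in> K. x \<otimes>\<^bsub>S\<^esub> y = y \<otimes>\<^bsub>S\<^esub> x}"

(* The restriction is needed because transitive_action maps into BijGroup A, whose elements are
   extensional on A, while \<phi> may act on a larger set. *)
definition acts_regularly_on ::
    "('a, 'b) monoid_scheme \<Rightarrow> ('a \<Rightarrow> 'c \<Rightarrow> 'c) \<Rightarrow> 'c set \<Rightarrow> bool"
  where "acts_regularly_on G \<phi> A \<longleftrightarrow>
    (\<forall>g \<in> carrier G. \<phi> g ` A = A) \<and>
    transitive_action G A (\<lambda>g. restrict (\<phi> g) A) \<and>
    (\<forall>x \<in> A. stabilizer G (\<lambda>g. restrict (\<phi> g) A) x = {\<one>\<^bsub>G\<^esub>})"

end

theory Submission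
  imports Defs
begin

text \<open>
  Transitivity of \<open>G\<close> leaves a centralising permutation little freedom: from \<open>c (g \<beta>) = g (c \<beta>)\<close> it is
  determined by the image of one point, and the point \<open>c \<beta>\<close> must have the same stabiliser as
  \<open>\<beta>\<close>. Conversely, whenever \<open>\<beta>\<close> and \<open>\<gamma>\<close> have the same stabiliser, the rule \<open>g \<beta> \<mapsto> g \<gamma>\<close> is well
  defined and gives a centralising permutation that takes \<open>\<beta>\<close> to \<open>\<gamma>\<close>
  (\<open>centralizer_transports_point\<close>). Hence the centraliser is regular on the set of all points with
  a given stabiliser.

  For the isomorphism, the point \<open>n \<alpha>\<close> has stabiliser \<open>n H n\<inverse>\<close>, so \<open>n\<close> normalises \<open>H\<close> exactly when \<open>n \<alpha>\<close>
  has stabiliser \<open>H\<close>. For such \<open>n\<close> regularity provides a unique centralising \<open>c\<close> with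
  \<open>c (n \<alpha>) = \<alpha>\<close>. The map \<open>n \<mapsto> c\<close> is a homomorphism, because \<open>c\<close> commutes with \<open>n\<close>; it is onto
  because the preimage of \<open>\<alpha>\<close> under a centralising permutation has the form \<open>n \<alpha>\<close> and has
  stabiliser \<open>H\<close>; and its kernel is \<open>H\<close>. The first isomorphism theorem finishes the proof.
  Sending \<open>n\<close> to the permutation that takes \<open>\<alpha>\<close> to \<open>n \<alpha>\<close> would reverse the order of products.
\<close>

section \<open>Centralisers and groups of bijections\<close>

lemma (in group) centralizer_subgroup:
  assumes "K \<subseteq> carrier G"
  shows "subgroup (centralizer G K) G"
proof (rule subgroupI)
  show "centralizer G K \<subseteq> carrier G" by (auto simp: centralizer_def)
  have "\<one> \<in> centralizer G K" using assms by (auto simp: centralizer_def)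
  then show "centralizer G K \<noteq> {}" by blast
next
  fix a assume a: "a \<in> centralizer G K"
  have "inv a \<otimes> y = y \<otimes> inv a" if "y \<in> K" for y
  proof -
    have "a \<in> carrier G" "y \<in> carrier G" "a \<otimes> y = y \<otimes> a"
      using a that assms by (auto simp: centralizer_def)
    then show ?thesis
      by (metis inv_closed inv_solve_left inv_solve_right m_assoc m_closed)
  qed
  then show "inv a \<in> centralizer G K" using a by (auto simp: centralizer_def)
next
  fix a b assume "a \<in> centralizer G K" "b \<in> centralizer G K"
  then show "a \<otimes> b \<in> centralizer G K"
    using assms by (auto simp: centralizer_def) (metis m_assoc subsetD)
qed

lemma BijGroup_mult_apply:
  assumes "f \<in> carrier (BijGroup E)" "g \<in> carrier (BijGroup E)" "x \<in> E"
  shows "(f \<otimes>\<^bsub>BijGroup E\<^esub> g) x = f (g x)"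
  using assms by (simp add: BijGroup_def compose_eq)

lemma BijGroup_apply_closed: "f \<in> carrier (BijGroup E) \<Longrightarrow> x \<in> E \<Longrightarrow> f x \<in> E"
  using Bij_imp_funcset[of f E] by (auto simp: BijGroup_def)

lemma BijGroup_eqI:
  assumes "f \<in> carrier (BijGroup E)" "g \<in> carrier (BijGroup E)" "\<And>x. x \<in> E \<Longrightarrow> f x = g x"
  shows "f = g"
  using assms by (auto simp: BijGroup_def intro!: extensionalityI[of _ E] Bij_imp_extensional)

lemma centralizer_BijGroup_iff:
  assumes "K \<subseteq> carrier (BijGroup E)"
  shows "c \<in> centralizer (BijGroup E) K \<longleftrightarrow>
    c \<in> carrier (BijGroup E) \<and> (\<forall>g\<in>K. \<forall>x\<in>E. c (g x) = g (c x))"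
proof -
  interpret group "BijGroup E" by (rule group_BijGroup)
  have "c \<otimes>\<^bsub>BijGroup E\<^esub> g = g \<otimes>\<^bsub>BijGroup E\<^esub> c \<longleftrightarrow> (\<forall>x\<in>E. c (g x) = g (c x))"
    if "c \<in> carrier (BijGroup E)" "g \<in> carrier (BijGroup E)" for g
    using that BijGroup_eqI[of "c \<otimes>\<^bsub>BijGroup E\<^esub> g" E "g \<otimes>\<^bsub>BijGroup E\<^esub> c"]
    by (metis BijGroup_mult_apply m_closed)
  then show ?thesis using assms by (auto simp: centralizer_def)
qed

section \<open>Invariant subsets, conjugate stabilisers and normalisers\<close>

lemma (in group_action) action_on_invariant_subset:
  assumes "A \<subseteq> E" and inv: "\<And>g. g \<in> carrier G \<Longrightarrow> \<phi> g ` A = A"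
  shows "group_action G A (\<lambda>g. restrict (\<phi> g) A)"
proof -
  interpret group_hom G "BijGroup E" \<phi> by (rule group_hom)
  have Bij: "restrict (\<phi> g) A \<in> Bij A" if "g \<in> carrier G" for g
    using inv[OF that] inj_on_subset[OF inj_prop[OF that] assms(1)]
    by (auto simp: Bij_def bij_betw_def inj_on_def)
  have "restrict (\<phi> (g \<otimes> h)) A = compose A (restrict (\<phi> g) A) (restrict (\<phi> h) A)"
    if gh: "g \<in> carrier G" "h \<in> carrier G" for g h
  proof
    fix x
    show "restrict (\<phi> (g \<otimes> h)) A x = compose A (restrict (\<phi> g) A) (restrict (\<phi> h) A) x"
      using gh composition_rule[of x g h] assms(1) inv[of h] by (auto simp: compose_def)
  qed
  then have "(\<lambda>g. restrict (\<phi> g) A) \<in> hom G (BijGroup A)"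
    using Bij by (auto simp: hom_def BijGroup_def)
  then show ?thesis
    by (simp add: group_action_def group_hom_def group_hom_axioms_def group_BijGroup)
qed

lemma (in group_action) stabilizer_image:
  assumes x: "x \<in> E" and g: "g \<in> carrier G"
  shows "stabilizer G \<phi> (\<phi> g x) = g <# stabilizer G \<phi> x #> inv g"
proof -
  interpret group G using group_hom by (rule group_hom.axioms)
  note gx = element_image[OF g x refl]
  show ?thesis
  proof (intro equalityI subsetI)
    fix k assume "k \<in> stabilizer G \<phi> (\<phi> g x)"
    then have k: "k \<in> carrier G" "\<phi> k (\<phi> g x) = \<phi> g x" by (auto simp: stabilizer_def)
    then have "\<phi> (inv g \<otimes> (k \<otimes> g)) x = x"
      using g x gx orbit_sym_aux[OF g x refl] by (simp add: composition_rule)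
    then have "inv g \<otimes> (k \<otimes> g) \<in> stabilizer G \<phi> x"
      using g k by (simp add: stabilizer_def)
    moreover have "k = g \<otimes> (inv g \<otimes> (k \<otimes> g)) \<otimes> inv g"
    proof -
      have "g \<otimes> (inv g \<otimes> k) = k" using g k by (simp flip: m_assoc)
      then show ?thesis using g k by (simp add: m_assoc)
    qed
    ultimately show "k \<in> g <# stabilizer G \<phi> x #> inv g"
      unfolding l_coset_def r_coset_def by blast
  next
    fix k assume "k \<in> g <# stabilizer G \<phi> x #> inv g"
    then obtain h where h: "h \<in> carrier G" "\<phi> h x = x" and k: "k = g \<otimes> h \<otimes> inv g"
      unfolding l_coset_def r_coset_def stabilizer_def by auto
    have "\<phi> k (\<phi> g x) = \<phi> g (\<phi> h (\<phi> (inv g) (\<phi> g x)))"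
      using g h gx element_image[of "inv g" "\<phi> g x"] unfolding k by (simp add: composition_rule)
    then show "k \<in> stabilizer G \<phi> (\<phi> g x)"
      using g h k orbit_sym_aux[OF g x refl] by (simp add: stabilizer_def)
  qed
qed

text \<open>Since conjugating a point stabiliser by \<open>g\<close> amounts to moving the point by \<open>g\<close>, membership in
  the normaliser becomes a condition on the point \<open>g x\<close> alone; this is the link between the
  normaliser and the set of points with a given stabiliser.\<close>

lemma (in group_action) normalizer_stabilizer_iff:
  assumes x: "x \<in> E"
  shows "g \<in> normalizer G (stabilizer G \<phi> x) \<longleftrightarrow>
    g \<in> carrier G \<and> stabilizer G \<phi> (\<phi> g x) = stabilizer G \<phi> x"
proof -
  have "g \<in> normalizer G H \<longleftrightarrow> g \<in> carrier G \<and> g <# H #> inv g = H"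
    if "H \<subseteq> carrier G" for H
    using that by (auto simp: normalizer_def stabilizer_def[where x = H])
  from this[OF stabilizer_subset] show ?thesis
    using stabilizer_image[OF x] by auto
qed

section \<open>The centraliser of a transitive permutation group\<close>

locale transitive_permutation_group =
  transitive_action "BijGroup \<Omega>\<lparr>carrier := G\<rparr>" \<Omega> "\<lambda>g. g" for \<Omega> :: "'a set" and G +
  assumes subgroup_BijGroup: "subgroup G (BijGroup \<Omega>)"
begin

abbreviation "S \<equiv> BijGroup \<Omega>"
abbreviation "C \<equiv> centralizer S G"
abbreviation "stab \<equiv> stabilizer (S\<lparr>carrier := G\<rparr>) (\<lambda>g. g)"

interpretation S: group S by (rule group_BijGroup)

lemma G_subset: "G \<subseteq> carrier S"
  by (rule subgroup.subset[OF subgroup_BijGroup])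

lemma mem_stab_iff: "g \<in> stab \<beta> \<longleftrightarrow> g \<in> G \<and> g \<beta> = \<beta>"
  by (simp add: stabilizer_def)

lemma transitiveE:
  assumes "\<beta> \<in> \<Omega>" "\<gamma> \<in> \<Omega>"
  obtains g where "g \<in> G" "g \<beta> = \<gamma>"
  using unique_orbit[OF assms] by auto

lemma G_closed: "g \<in> G \<Longrightarrow> x \<in> \<Omega> \<Longrightarrow> g x \<in> \<Omega>"
  by (rule BijGroup_apply_closed[OF subsetD[OF G_subset]])

lemma centralizer_subgroup_S: "subgroup C S"
  by (rule S.centralizer_subgroup[OF G_subset])

lemma centralizer_subset: "C \<subseteq> carrier S"
  by (rule subgroup.subset[OF centralizer_subgroup_S])

lemma centralizer_closed: "c \<in> C \<Longrightarrow> x \<in> \<Omega> \<Longrightarrow> c x \<in> \<Omega>"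
  by (rule BijGroup_apply_closed[OF subsetD[OF centralizer_subset]])

lemma centralizer_mult_apply:
  "c \<in> C \<Longrightarrow> d \<in> C \<Longrightarrow> x \<in> \<Omega> \<Longrightarrow> (c \<otimes>\<^bsub>S\<^esub> d) x = c (d x)"
  by (rule BijGroup_mult_apply[OF subsetD[OF centralizer_subset] subsetD[OF centralizer_subset]])

lemma centralizer_commutes: "c \<in> C \<Longrightarrow> g \<in> G \<Longrightarrow> x \<in> \<Omega> \<Longrightarrow> c (g x) = g (c x)"
  using centralizer_BijGroup_iff[OF G_subset, of c] by simp

text \<open>Two commuting permutations that agree at \<open>\<beta>\<close> agree at every \<open>g \<beta>\<close>, and these points fill
  \<open>\<Omega>\<close>. This yields both the freeness of the centraliser and the uniqueness that the homomorphism
  from the normaliser relies on.\<close>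

lemma centralizer_eqI:
  assumes c: "c \<in> C" and d: "d \<in> C" and \<beta>: "\<beta> \<in> \<Omega>" and eq: "c \<beta> = d \<beta>"
  shows "c = d"
proof (rule BijGroup_eqI[of _ \<Omega>])
  fix x assume x: "x \<in> \<Omega>"
  obtain g where g: "g \<in> G" "g \<beta> = x" using transitiveE[OF \<beta> x] .
  show "c x = d x"
    using centralizer_commutes[OF c g(1) \<beta>] centralizer_commutes[OF d g(1) \<beta>] g(2) eq by simp
qed (use c d centralizer_subset in auto)

lemma centralizer_preserves_stab:
  assumes "c \<in> C" "\<beta> \<in> \<Omega>"
  shows "stab (c \<beta>) = stab \<beta>"
proof -
  have "inj_on c \<Omega>"
    using assms centralizer_subset by (auto simp: BijGroup_def Bij_def bij_betw_def)
  then have "c (g \<beta>) = c \<beta> \<longleftrightarrow> g \<beta> = \<beta>" if "g \<in> G" for g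
    using that assms G_closed by (auto dest: inj_onD)
  then show ?thesis
    using centralizer_commutes[OF assms(1) _ assms(2)] by (auto simp: mem_stab_iff)
qed

text \<open>Both sides say that \<open>h\<inverse> g\<close> lies in the common stabiliser. Read from left to right, this makes
  the rule \<open>g \<beta> \<mapsto> g \<gamma>\<close> single-valued; read from right to left, it makes it injective.\<close>

lemma eq_iff_of_stab_eq:
  assumes stab: "stab \<beta> = stab \<gamma>" and \<beta>: "\<beta> \<in> \<Omega>" and \<gamma>: "\<gamma> \<in> \<Omega>"
    and g: "g \<in> G" and h: "h \<in> G"
  shows "g \<beta> = h \<beta> \<longleftrightarrow> g \<gamma> = h \<gamma>"
proof -
  interpret GG: group "S\<lparr>carrier := G\<rparr>" by (rule S.subgroup_imp_group[OF subgroup_BijGroup])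
  let ?k = "inv\<^bsub>S\<lparr>carrier := G\<rparr>\<^esub> h"
  have k: "?k \<in> G" using GG.inv_closed h by simp
  have "g \<delta> = h \<delta> \<longleftrightarrow> ?k \<otimes>\<^bsub>S\<^esub> g \<in> stab \<delta>" if \<delta>: "\<delta> \<in> \<Omega>" for \<delta>
  proof -
    have "g \<delta> = h \<delta>" if "?k (g \<delta>) = \<delta>"
    proof -
      have "h (?k (g \<delta>)) = (h \<otimes>\<^bsub>S\<^esub> ?k) (g \<delta>)"
        using composition_rule[of "g \<delta>" h ?k] h k G_closed[OF g \<delta>] by simp
      also have "\<dots> = g \<delta>"
        using GG.r_inv[of h] h G_closed[OF g \<delta>] by (simp add: BijGroup_def)
      finally show ?thesis using that by simp
    qed
    moreover have "?k (h \<delta>) = \<delta>"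
      using orbit_sym_aux[of h \<delta>] h \<delta> by simp
    moreover have "(?k \<otimes>\<^bsub>S\<^esub> g) \<delta> = ?k (g \<delta>)"
      using composition_rule[of \<delta> ?k g] k g \<delta> by simp
    moreover have "?k \<otimes>\<^bsub>S\<^esub> g \<in> G" using subgroup.m_closed[OF subgroup_BijGroup k g] .
    ultimately show ?thesis by (auto simp: mem_stab_iff)
  qed
  then show ?thesis using stab \<beta> \<gamma> by blast
qed

text \<open>The set of pairs \<open>(g \<beta>, g \<gamma>)\<close> with \<open>g \<in> G\<close> is the graph of the required permutation:
  \<open>eq_iff_of_stab_eq\<close> makes it single-valued and injective, transitivity makes it total and onto, and
  it commutes with \<open>G\<close> because \<open>G\<close> acts on both coordinates from the left.\<close>

lemma centralizer_transports_point:
  assumes \<beta>: "\<beta> \<in> \<Omega>" and \<gamma>: "\<gamma> \<in> \<Omega>" and stab: "stab \<beta> = stab \<gamma>"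
  obtains c where "c \<in> C" "c \<beta> = \<gamma>"
proof -
  define c where "c = (\<lambda>x\<in>\<Omega>. (SOME g. g \<in> G \<and> g \<beta> = x) \<gamma>)"
  have c: "c (g \<beta>) = g \<gamma>" if g: "g \<in> G" for g
  proof -
    let ?h = "SOME h. h \<in> G \<and> h \<beta> = g \<beta>"
    have "\<exists>h. h \<in> G \<and> h \<beta> = g \<beta>" using g by blast
    from someI_ex[OF this] have "?h \<gamma> = g \<gamma>"
      using eq_iff_of_stab_eq[OF stab \<beta> \<gamma> _ g, of ?h] by blast
    then show ?thesis using G_closed[OF g \<beta>] by (simp add: c_def)
  qed
  have "inj_on c \<Omega>"
  proof (rule inj_onI)
    fix x y assume x: "x \<in> \<Omega>" and y: "y \<in> \<Omega>" and eq: "c x = c y"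
    obtain g where "g \<in> G" "g \<beta> = x" using transitiveE[OF \<beta> x] .
    moreover obtain h where "h \<in> G" "h \<beta> = y" using transitiveE[OF \<beta> y] .
    ultimately show "x = y" using c[of g] c[of h] eq eq_iff_of_stab_eq[OF stab \<beta> \<gamma>, of g h] by simp
  qed
  moreover have "c ` \<Omega> = \<Omega>"
  proof (intro equalityI subsetI)
    fix y assume "y \<in> c ` \<Omega>"
    then obtain x where x: "x \<in> \<Omega>" "y = c x" by blast
    obtain g where "g \<in> G" "g \<beta> = x" using transitiveE[OF \<beta> x(1)] .
    then show "y \<in> \<Omega>" using x c[of g] G_closed[OF _ \<gamma>, of g] by simp
  next
    fix y assume y: "y \<in> \<Omega>"
    obtain g where g: "g \<in> G" "g \<gamma> = y" using transitiveE[OF \<gamma> y] .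
    show "y \<in> c ` \<Omega>"
      using imageI[OF G_closed[OF g(1) \<beta>], of c] c[OF g(1)] g(2) by simp
  qed
  moreover have "c \<in> extensional \<Omega>" by (simp add: c_def)
  ultimately have "c \<in> carrier S" by (simp add: BijGroup_def Bij_def bij_betw_def)
  moreover have "c (g x) = g (c x)" if g: "g \<in> G" and x: "x \<in> \<Omega>" for g x
  proof -
    obtain h where h: "h \<in> G" "h \<beta> = x" using transitiveE[OF \<beta> x] .
    have "g \<otimes>\<^bsub>S\<^esub> h \<in> G" using subgroup.m_closed[OF subgroup_BijGroup g h(1)] .
    from c[OF this] show ?thesis
      using composition_rule[of _ g h] g h c[OF h(1)] \<beta> \<gamma> by simp
  qed
  ultimately have "c \<in> C" using centralizer_BijGroup_iff[OF G_subset, of c] by simp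
  moreover have "c \<beta> = \<gamma>"
    using c[OF subgroup.one_closed[OF subgroup_BijGroup]] \<beta> \<gamma> by (simp add: BijGroup_def)
  ultimately show thesis by (rule that)
qed

section \<open>Regularity and the quotient of the normaliser\<close>

text \<open>The centraliser keeps stabilisers fixed, so it acts on the points with stabiliser \<open>H\<close>;
  \<open>centralizer_transports_point\<close> is transitivity of this action and \<open>centralizer_eqI\<close>, applied to the
  identity, is its freeness. For an \<open>H\<close> that is not a point stabiliser the set is empty and the claim
  holds vacuously.\<close>

theorem centralizer_acts_regularly:
  "acts_regularly_on (S\<lparr>carrier := C\<rparr>) (\<lambda>c. c) {\<beta> \<in> \<Omega>. stab \<beta> = H}"
  (is "acts_regularly_on ?C _ ?\<Phi>")
proof -
  have "group_action S \<Omega> (\<lambda>g. g)"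
    by (auto simp: group_action_def group_hom_def group_hom_axioms_def hom_def group_BijGroup)
  then interpret CA: group_action ?C \<Omega> "\<lambda>c. c"
    using group_action.induced_action centralizer_subgroup_S by blast
  have inv: "c ` ?\<Phi> = ?\<Phi>" if c: "c \<in> C" for c
  proof (intro equalityI subsetI)
    fix y assume "y \<in> c ` ?\<Phi>"
    then show "y \<in> ?\<Phi>" using c centralizer_closed centralizer_preserves_stab by auto
  next
    fix y assume y: "y \<in> ?\<Phi>"
    then have "y \<in> c ` \<Omega>" using CA.surj_prop[of c] c by simp
    then obtain x where "x \<in> \<Omega>" "c x = y" by blast
    then show "y \<in> c ` ?\<Phi>" using y c centralizer_preserves_stab by auto
  qed
  have "group_action ?C ?\<Phi> (\<lambda>c. restrict c ?\<Phi>)"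
    using CA.action_on_invariant_subset[of ?\<Phi>] inv by simp
  moreover have "\<exists>c\<in>C. restrict c ?\<Phi> x = y" if "x \<in> ?\<Phi>" "y \<in> ?\<Phi>" for x y
    using that centralizer_transports_point[of x y] by auto
  ultimately have "transitive_action ?C ?\<Phi> (\<lambda>c. restrict c ?\<Phi>)"
    by (simp add: transitive_action_def transitive_action_axioms_def)
  moreover have "stabilizer ?C (\<lambda>c. restrict c ?\<Phi>) x = {\<one>\<^bsub>?C\<^esub>}" if x: "x \<in> ?\<Phi>" for x
  proof -
    have one: "\<one>\<^bsub>S\<^esub> \<in> C" "\<one>\<^bsub>S\<^esub> x = x"
      using x subgroup.one_closed[OF centralizer_subgroup_S] by (auto simp: BijGroup_def)
    then have "c \<in> C \<and> c x = x \<longleftrightarrow> c = \<one>\<^bsub>S\<^esub>" for c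
      using x centralizer_eqI[of c "\<one>\<^bsub>S\<^esub>" x] by auto
    then show ?thesis using x by (simp add: stabilizer_def)
  qed
  ultimately show ?thesis using inv by (simp add: acts_regularly_on_def)
qed

text \<open>The homomorphism is built from the normaliser to the centraliser, so that no map has to be
  defined on cosets: its kernel turns out to be the stabiliser, and the first isomorphism theorem
  supplies the quotient.\<close>

theorem centralizer_iso_normalizer_Mod_stab:
  assumes \<alpha>: "\<alpha> \<in> \<Omega>"
  shows "S\<lparr>carrier := C\<rparr> \<cong>
    S\<lparr>carrier := normalizer (S\<lparr>carrier := G\<rparr>) (stab \<alpha>)\<rparr> Mod stab \<alpha>"
proof -
  let ?N = "normalizer (S\<lparr>carrier := G\<rparr>) (stab \<alpha>)"
  interpret GG: group "S\<lparr>carrier := G\<rparr>" by (rule S.subgroup_imp_group[OF subgroup_BijGroup])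
  have N_iff: "n \<in> ?N \<longleftrightarrow> n \<in> G \<and> stab (n \<alpha>) = stab \<alpha>" for n
    using normalizer_stabilizer_iff[OF \<alpha>] by simp
  have N: "subgroup ?N S"
    by (rule S.incl_subgroup[OF subgroup_BijGroup GG.normalizer_imp_subgroup[OF stabilizer_subset]])
  define f where "f n = (THE c. c \<in> C \<and> c (n \<alpha>) = \<alpha>)" for n
  have f_eqI: "f n = c" if "n \<in> ?N" "c \<in> C" "c (n \<alpha>) = \<alpha>" for n c
  proof -
    have "n \<alpha> \<in> \<Omega>" using that(1) N_iff[of n] G_closed[of n \<alpha>] \<alpha> by simp
    then have "d = c" if "d \<in> C \<and> d (n \<alpha>) = \<alpha>" for d
      using centralizer_eqI[of d c "n \<alpha>"] \<open>c \<in> C\<close> \<open>c (n \<alpha>) = \<alpha>\<close> that by simp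
    then show ?thesis
      unfolding f_def using that(2,3) by (intro the_equality[where a = c] conjI)
  qed
  have f: "f n \<in> C" "f n (n \<alpha>) = \<alpha>" if n: "n \<in> ?N" for n
  proof -
    have "n \<alpha> \<in> \<Omega>" "stab (n \<alpha>) = stab \<alpha>" using n N_iff[of n] G_closed[of n \<alpha>] \<alpha> by simp_all
    then obtain c where "c \<in> C" "c (n \<alpha>) = \<alpha>" by (rule centralizer_transports_point[OF _ \<alpha>])
    moreover from this have "f n = c" by (rule f_eqI[OF n])
    ultimately show "f n \<in> C" "f n (n \<alpha>) = \<alpha>" by simp_all
  qed
  have mult: "f (n \<otimes>\<^bsub>S\<^esub> m) = f n \<otimes>\<^bsub>S\<^esub> f m" if n: "n \<in> ?N" and m: "m \<in> ?N" for n m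
  proof (rule f_eqI)
    show "n \<otimes>\<^bsub>S\<^esub> m \<in> ?N" using subgroup.m_closed[OF N n m] .
    show "f n \<otimes>\<^bsub>S\<^esub> f m \<in> C"
      using subgroup.m_closed[OF centralizer_subgroup_S f(1)[OF n] f(1)[OF m]] .
    have G: "n \<in> G" "m \<in> G" using n m N_iff by auto
    have "(f n \<otimes>\<^bsub>S\<^esub> f m) ((n \<otimes>\<^bsub>S\<^esub> m) \<alpha>) = f n (f m (n (m \<alpha>)))"
      using centralizer_mult_apply[OF f(1)[OF n] f(1)[OF m], of "n (m \<alpha>)"]
        composition_rule[of \<alpha> n m] G \<alpha> G_closed by simp
    \<comment> \<open>Moving \<open>f m\<close> past \<open>n\<close> lets it cancel \<open>m\<close> at \<open>\<alpha>\<close>; this is what keeps the factors in order.\<close>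
    also have "f m (n (m \<alpha>)) = n \<alpha>"
      using centralizer_commutes[OF f(1)[OF m] G(1) G_closed[OF G(2) \<alpha>]] f(2)[OF m] by simp
    also have "f n (n \<alpha>) = \<alpha>" by (rule f(2)[OF n])
    finally show "(f n \<otimes>\<^bsub>S\<^esub> f m) ((n \<otimes>\<^bsub>S\<^esub> m) \<alpha>) = \<alpha>" .
  qed
  interpret f: group_hom "S\<lparr>carrier := ?N\<rparr>" "S\<lparr>carrier := C\<rparr>" f
    using S.subgroup_imp_group[OF N] S.subgroup_imp_group[OF centralizer_subgroup_S] f(1) mult
    by (auto simp: group_hom_def group_hom_axioms_def hom_def)
  have onto: "f ` ?N = C"
  proof (intro equalityI subsetI)
    fix c assume c: "c \<in> C"
    then have "\<alpha> \<in> c ` \<Omega>"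
      using centralizer_subset \<alpha> by (auto simp: BijGroup_def Bij_def bij_betw_def)
    then obtain x where x: "x \<in> \<Omega>" "c x = \<alpha>" by blast
    obtain n where n: "n \<in> G" "n \<alpha> = x" using transitiveE[OF \<alpha> x(1)] .
    then have "n \<in> ?N" using N_iff centralizer_preserves_stab[OF c x(1)] x by simp
    moreover from this have "f n = c" using f_eqI[of n c] c x n by simp
    ultimately show "c \<in> f ` ?N" by blast
  qed (use f in auto)
  have one_C: "\<one>\<^bsub>S\<^esub> \<in> C" by (rule subgroup.one_closed[OF centralizer_subgroup_S])
  have "f n = \<one>\<^bsub>S\<^esub> \<longleftrightarrow> n \<alpha> = \<alpha>" if n: "n \<in> ?N" for n
  proof -
    have "\<one>\<^bsub>S\<^esub> (n \<alpha>) = n \<alpha>" using n N_iff[of n] G_closed[of n \<alpha>] \<alpha> by (simp add: BijGroup_def)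
    then show ?thesis using f(2)[OF n] f_eqI[OF n one_C] by auto
  qed
  then have "kernel (S\<lparr>carrier := ?N\<rparr>) (S\<lparr>carrier := C\<rparr>) f = stab \<alpha>"
    by (auto simp: kernel_def mem_stab_iff N_iff)
  then have "S\<lparr>carrier := ?N\<rparr> Mod stab \<alpha> \<cong> S\<lparr>carrier := C\<rparr>"
    using f.FactGroup_iso onto by simp
  moreover have "group (S\<lparr>carrier := ?N\<rparr> Mod stab \<alpha>)"
    using normal.factorgroup_is_group[OF f.normal_kernel]
      \<open>kernel (S\<lparr>carrier := ?N\<rparr>) (S\<lparr>carrier := C\<rparr>) f = stab \<alpha>\<close> by simp
  ultimately show ?thesis by (rule group.iso_sym[rotated])
qed

end

theorem theorem2:
  fixes \<Omega> \<Phi> :: "'a set" and \<alpha> :: 'a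
    and S :: "('a \<Rightarrow> 'a) monoid"
    and G H C :: "('a \<Rightarrow> 'a) set"
  assumes "S = BijGroup \<Omega>"
    and "subgroup G S"
    and "transitive_action (S\<lparr>carrier := G\<rparr>) \<Omega> (\<lambda>g. g)"
    and "\<alpha> \<in> \<Omega>"
    and "H = stabilizer (S\<lparr>carrier := G\<rparr>) (\<lambda>g. g) \<alpha>"
    and "C = centralizer S G"
    and "\<Phi> = {\<beta> \<in> \<Omega>. stabilizer (S\<lparr>carrier := G\<rparr>) (\<lambda>g. g) \<beta> = H}"
  shows "(S\<lparr>carrier := C\<rparr> \<cong>
            (S\<lparr>carrier := normalizer (S\<lparr>carrier := G\<rparr>) H\<rparr>) Mod H) \<and>
         acts_regularly_on (S\<lparr>carrier := C\<rparr>) (\<lambda>c. c) \<Phi>"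
proof -
  interpret transitive_permutation_group \<Omega> G
    using assms(1-3)
    by (simp add: transitive_permutation_group_def transitive_permutation_group_axioms_def)
  show ?thesis
    using centralizer_iso_normalizer_Mod_stab[OF assms(4)] centralizer_acts_regularly assms by simp
qed

end
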